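(* Let $X_N=\{\mathbf{x}_1,\dots,\mathbf{x}_N\}\subseteq\mathbb{S}^2$ and $\mathbf{w}\in\mathbb{R}^N$. Suppose the quadrature $Q[X_N,\mathbf{w}]$ satisfies an $L^2$ Marcinkiewicz–Zygmund (MZ) inequality of degree $n\in\mathbb{N}_0$ with constants $A\le B$. Let $\eta:=\max\{|1-A|,|1-B|\}$, and let $L_n$ be the hyperinterpolation operator associated with $Q[X_N,\mathbf{w}]$. Then $$\|L_np-p\|_{L^2}\le\eta\,\|p\|_{L^2}\qquad\forall\,p\in\mathbb{P}_n(\mathbb{S}^2).$$
   Context: $\mathbb{S}^2$ is the unit sphere in $\mathbb{R}^3$ with surface measure $\omega$ of total mass $4\pi$; $\|\cdot\|_{L^2}$ is the $L^2(\mathbb{S}^2,\omega)$ norm; $I(f)=\int_{\mathbb{S}^2}f\,d\omega$. $\mathbb{P}_n(\mathbb{S}^2)$ is the space of real spherical polynomials of degree at most $n$. The quadrature is $Q[X_N,\mathbf{w}](f):=\sum_{j=1}^Nw_jf(\mathbf{x}_j)$ (weights of any sign). It satisfies an $L^2$ MZ inequality of degree $n$ with constants $A,B$ if $A\le1\le B$ and $A\,I(f^2)\le Q[X_N,\mathbf{w}](f^2)\le B\,I(f^2)$ for all $f\in\mathbb{P}_n(\mathbb{S}^2)$. The hyperinterpolation operator $L_n:C(\mathbb{S}^2)\to\mathbb{P}_n(\mathbb{S}^2)$ is $L_nf(\mathbf{x}):=\sum_{j=1}^Nw_jf(\mathbf{x}_j)G_n(\mathbf{x},\mathbf{x}_j)$,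 where $G_n(\mathbf{x},\mathbf{y}):=\sum_{\ell=0}^n\frac{2\ell+1}{4\pi}P_\ell(\langle\mathbf{x},\mathbf{y}\rangle)$ is the reproducing kernel of $\mathbb{P}_n(\mathbb{S}^2)$ with the $L^2$ inner product and $P_\ell$ is the Legendre polynomial of degree $\ell$ with $P_\ell(1)=1$. *)

theory Defs
  imports "HOL-Analysis.Analysis" "HOL-Computational_Algebra.Polynomial"
begin

abbreviation S2 :: "(real ^ 3) set" where
  "S2 \<equiv> sphere 0 1"

text \<open>
  Surface measure on the sphere, by polar decomposition of Lebesgue measure:
  \<open>\<omega>(A) = 3 vol {r x | 0 < r < 1, x \<in> A}\<close> for Borel sets \<open>A\<close>. The factor is the dimension, since
  \<open>dx = r\<^sup>2 dr d\<omega>\<close> and the integral of \<open>r\<^sup>2\<close> over \<open>(0,1)\<close> is \<open>1/3\<close>. It is proved below to be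
  rotation invariant and of total mass \<open>4\<pi>\<close>, which determines it among Borel measures.
\<close>

definition surface_measure :: "(real ^ 3) measure" where
  "surface_measure =
     scale_measure 3
       (distr (restrict_space lborel (ball 0 1 - {0})) (restrict_space borel S2) sgn)"

lemma space_surface_measure: "space surface_measure = S2"
  by (simp add: surface_measure_def space_scale_measure space_restrict_space)

lemma sets_surface_measure: "sets surface_measure = sets (restrict_space borel S2)"
  by (simp add: surface_measure_def)

lemma measurable_sgn_S2:
  "sgn \<in> restrict_space lborel (ball 0 1 - {0 :: real ^ 3}) \<rightarrow>\<^sub>M restrict_space borel S2"
proof (rule measurable_restrict_space2)
  show "sgn \<in> space (restrict_space lborel (ball 0 1 - {0 :: real ^ 3})) \<rightarrow> S2"
    by (auto simp: space_restrict_space norm_sgn)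
  have "(sgn :: real ^ 3 \<Rightarrow> _) \<in> borel_measurable borel"
    unfolding sgn_div_norm[abs_def] by measurable
  then show "sgn \<in> borel_measurable (restrict_space lborel (ball 0 1 - {0 :: real ^ 3}))"
    by (intro measurable_restrict_space1) simp
qed

lemma emeasure_surface_measure:
  assumes "A \<in> sets surface_measure"
  shows "emeasure surface_measure A
         = 3 * emeasure lborel {x \<in> ball 0 1 - {0}. sgn x \<in> A}"
proof -
  have A: "A \<in> sets (restrict_space borel S2)"
    using assms by (simp add: sets_surface_measure)
  have eq: "sgn -` A \<inter> space (restrict_space lborel (ball 0 1 - {0 :: real ^ 3}))
      = {x \<in> ball 0 1 - {0}. sgn x \<in> A}"
    by (auto simp: space_restrict_space)
  have "emeasure surface_measure A
      = 3 * emeasure (restrict_space lborel (ball 0 1 - {0 :: real ^ 3})) {x \<in> ball 0 1 - {0}. sgn x \<in> A}"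
    unfolding surface_measure_def emeasure_scale_measure
      emeasure_distr[OF measurable_sgn_S2 A] eq ..
  also have "emeasure (restrict_space lborel (ball 0 1 - {0 :: real ^ 3})) {x \<in> ball 0 1 - {0}. sgn x \<in> A}
      = emeasure lborel {x \<in> ball 0 1 - {0}. sgn x \<in> A}"
    by (rule emeasure_restrict_space) auto
  finally show ?thesis .
qed

lemma emeasure_surface_measure_S2: "emeasure surface_measure S2 = 4 * pi"
proof -
  have "S2 \<in> sets surface_measure"
    using sets.top[of surface_measure] by (simp add: space_surface_measure)
  then have "emeasure surface_measure S2 = 3 * emeasure lborel {x \<in> ball 0 1 - {0 :: real ^ 3}. sgn x \<in> S2}"
    by (rule emeasure_surface_measure)
  also have "{x \<in> ball 0 1 - {0 :: real ^ 3}. sgn x \<in> S2} = ball 0 1 - {0}"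
    by (auto simp: norm_sgn)
  also have "emeasure lborel (ball 0 1 - {0 :: real ^ 3}) = emeasure lborel (ball 0 1 :: (real ^ 3) set)"
    by (subst emeasure_Diff) auto
  also have "\<dots> = ennreal (4 / 3 * pi)"
    by (simp add: emeasure_ball eval_unit_ball_vol)
  also have "3 * ennreal (4 / 3 * pi) = ennreal (4 * pi)"
    by (subst ennreal_numeral[symmetric], subst ennreal_mult[symmetric]) auto
  finally show ?thesis .
qed

lemma surface_measure_rotation_invariant:
  fixes T :: "real ^ 3 \<Rightarrow> real ^ 3"
  assumes T: "orthogonal_transformation T" and A: "A \<in> sets surface_measure"
  shows "T ` A \<in> sets surface_measure"
    and "emeasure surface_measure (T ` A) = emeasure surface_measure A"
proof -
  have nT: "norm (T x) = norm x" for x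
    using T by (simp add: orthogonal_transformation_norm)
  have lin: "linear T"
    using T by (rule orthogonal_transformation_linear)
  have bT: "bij T"
    using T by (rule orthogonal_transformation_bij)
  have T': "orthogonal_transformation (inv T)"
    using T by (rule orthogonal_transformation_inv)
  have inv_meas: "inv T \<in> borel \<rightarrow>\<^sub>M borel"
    using orthogonal_transformation_linear[OF T']
    by (intro borel_measurable_continuous_onI linear_continuous_on)
       (simp add: linear_conv_bounded_linear)
  have img: "T ` B = inv T -` B" for B
    using bT by (simp add: bij_vimage_eq_inv_image bij_imp_bij_inv inv_inv_eq)
  have img_borel: "T ` B \<in> sets borel" if "B \<in> sets borel" for B
    using measurable_sets[OF inv_meas that] by (simp add: img)
  have A': "A \<in> sets borel" "A \<subseteq> S2"
    using A by (auto simp: sets_surface_measure sets_restrict_space)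
  have "T ` A \<subseteq> S2"
    using A' nT by auto
  with img_borel[OF A'(1)] show TA: "T ` A \<in> sets surface_measure"
    by (auto simp: sets_surface_measure sets_restrict_space)
  define C where "C = {x \<in> ball 0 1 - {0 :: real ^ 3}. sgn x \<in> A}"
  have sgnT: "sgn (T x) = T (sgn x)" for x
    by (simp add: sgn_div_norm nT linear_scale[OF lin])
  have injT: "inj T"
    using bT by (rule bij_is_inj)
  have CT: "{x \<in> ball 0 1 - {0}. sgn x \<in> T ` A} = T ` C"
  proof (intro set_eqI iffI)
    fix x assume x: "x \<in> {x \<in> ball 0 1 - {0}. sgn x \<in> T ` A}"
    obtain y where y: "x = T y"
      using bT by (metis bij_pointE)
    have "sgn y \<in> A"
      using x injT by (auto simp: y sgnT inj_image_mem_iff)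
    moreover have "y \<in> ball 0 1 - {0}"
      using x nT[of y] by (auto simp: y linear_0[OF lin])
    ultimately show "x \<in> T ` C"
      by (auto simp: C_def y)
  next
    fix x assume "x \<in> T ` C"
    then obtain y where y: "x = T y" "y \<in> C" by blast
    then have "T y \<noteq> 0"
      using nT[of y] by (auto simp: C_def)
    with y show "x \<in> {x \<in> ball 0 1 - {0}. sgn x \<in> T ` A}"
      by (auto simp: C_def sgnT nT)
  qed
  have Cb: "C \<in> sets borel"
  proof -
    have "sgn -` A \<inter> space (restrict_space lborel (ball 0 1 - {0 :: real ^ 3}))
        \<in> sets (restrict_space lborel (ball 0 1 - {0 :: real ^ 3}))"
      using A by (intro measurable_sets[OF measurable_sgn_S2]) (simp add: sets_surface_measure)
    also have "sgn -` A \<inter> space (restrict_space lborel (ball 0 1 - {0 :: real ^ 3})) = C"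
      by (auto simp: space_restrict_space C_def)
    finally have "C \<in> sets (restrict_space lborel (ball 0 1 - {0 :: real ^ 3}))" .
    then show ?thesis
      by (subst (asm) sets_restrict_space_iff) auto
  qed
  have "C \<subseteq> ball 0 1"
    by (auto simp: C_def)
  then have lm: "C \<in> lmeasurable"
    using Cb by (intro bounded_set_imp_lmeasurable) (auto intro: bounded_subset)
  have "emeasure lborel (T ` C) = emeasure lebesgue (T ` C)"
    using img_borel[OF Cb] by simp
  also have "\<dots> = ennreal (measure lebesgue (T ` C))"
    by (intro emeasure_eq_measure2 measurable_orthogonal_image[OF T lm])
  also have "\<dots> = ennreal (measure lebesgue C)"
    by (simp add: measure_orthogonal_image[OF T lm])
  also have "\<dots> = emeasure lebesgue C"
    by (rule emeasure_eq_measure2[symmetric, OF lm])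
  also have "\<dots> = emeasure lborel C"
    using Cb by simp
  finally show "emeasure surface_measure (T ` A) = emeasure surface_measure A"
    unfolding emeasure_surface_measure[OF A] emeasure_surface_measure[OF TA] CT C_def by simp
qed

definition sphere_integral :: "(real ^ 3 \<Rightarrow> real) \<Rightarrow> real" where
  "sphere_integral f = (LINT x|surface_measure. f x)"

definition sphere_L2_norm :: "(real ^ 3 \<Rightarrow> real) \<Rightarrow> real" where
  "sphere_L2_norm f = sqrt (sphere_integral (\<lambda>x. (f x)\<^sup>2))"

text \<open>
  Spherical polynomials of degree at most \<open>n\<close>: restrictions to the sphere of real polynomials in
  three variables of total degree at most \<open>n\<close>. A function on the sphere is represented by
  any function on the ambient space; only its values on the sphere matter.
\<close>

definition spherical_polynomials :: "nat \<Rightarrow> (real ^ 3 \<Rightarrow> real) set" where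
  "spherical_polynomials n =
     {f. \<exists>c :: nat \<Rightarrow> nat \<Rightarrow> nat \<Rightarrow> real. \<forall>x\<in>S2.
           f x = (\<Sum>(i, j, k) | i + j + k \<le> n. c i j k * (x $ 1) ^ i * (x $ 2) ^ j * (x $ 3) ^ k)}"

lemma finite_exponents_le: "finite {(i, j, k). i + j + k \<le> (n :: nat)}"
  by (rule finite_subset[of _ "{..n} \<times> {..n} \<times> {..n}"]) auto

text \<open>Rodrigues' formula.\<close>

definition legendre_poly :: "nat \<Rightarrow> real poly" where
  "legendre_poly l = smult (1 / (2 ^ l * fact l)) ((pderiv ^^ l) ([:-1, 0, 1:] ^ l))"

lemma degree_legendre_poly: "degree (legendre_poly l) = l"
  by (simp add: legendre_poly_def degree_higher_pderiv degree_power_eq)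

lemma higher_pderiv_linear_power:
  fixes a :: real
  shows "poly ((pderiv ^^ l) ([:-a, 1:] ^ l * q)) a = fact l * poly q a"
proof (induction l arbitrary: q)
  case (Suc l)
  have "pderiv ([:-a, 1:] ^ Suc l * q)
      = [:-a, 1:] ^ l * (smult (of_nat (Suc l)) q + [:-a, 1:] * pderiv q)"
    unfolding pderiv_mult pderiv_power_Suc by (simp add: pderiv_pCons algebra_simps)
  then show ?case
    by (simp only: funpow_Suc_right o_apply Suc) (simp add: algebra_simps)
qed simp

lemma legendre_poly_1: "poly (legendre_poly l) 1 = 1"
proof -
  have "[:-1, 0, 1 :: real:] = [:-1, 1:] * [:1, 1:]"
    by simp
  then have "[:-1, 0, 1 :: real:] ^ l = [:-1, 1:] ^ l * [:1, 1:] ^ l"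
    by (metis power_mult_distrib)
  then show ?thesis
    by (simp add: legendre_poly_def higher_pderiv_linear_power[of l 1, simplified] poly_power)
qed

definition reproducing_kernel :: "nat \<Rightarrow> real ^ 3 \<Rightarrow> real ^ 3 \<Rightarrow> real" where
  "reproducing_kernel n x y =
     (\<Sum>l\<le>n. (2 * real l + 1) / (4 * pi) * poly (legendre_poly l) (x \<bullet> y))"

definition quadrature ::
    "nat \<Rightarrow> (nat \<Rightarrow> real ^ 3) \<Rightarrow> (nat \<Rightarrow> real) \<Rightarrow> (real ^ 3 \<Rightarrow> real) \<Rightarrow> real" where
  "quadrature N X w f = (\<Sum>j = 1..N. w j * f (X j))"

definition L2_MZ_inequality ::
    "nat \<Rightarrow> (nat \<Rightarrow> real ^ 3) \<Rightarrow> (nat \<Rightarrow> real) \<Rightarrow> nat \<Rightarrow> real \<Rightarrow> real \<Rightarrow> bool" where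
  "L2_MZ_inequality N X w n A B \<longleftrightarrow>
     A \<le> 1 \<and> 1 \<le> B \<and>
     (\<forall>f \<in> spherical_polynomials n.
        A * sphere_integral (\<lambda>x. (f x)\<^sup>2) \<le> quadrature N X w (\<lambda>x. (f x)\<^sup>2) \<and>
        quadrature N X w (\<lambda>x. (f x)\<^sup>2) \<le> B * sphere_integral (\<lambda>x. (f x)\<^sup>2))"

definition hyperinterpolation ::
    "nat \<Rightarrow> (nat \<Rightarrow> real ^ 3) \<Rightarrow> (nat \<Rightarrow> real) \<Rightarrow> nat \<Rightarrow> (real ^ 3 \<Rightarrow> real) \<Rightarrow> real ^ 3 \<Rightarrow> real" where
  "hyperinterpolation N X w n f x =
     (\<Sum>j = 1..N. w j * f (X j) * reproducing_kernel n x (X j))"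

end

theory Submission
  imports Defs
begin

text \<open>
  Write \<open>r = L\<^sub>n p - p\<close>. Since \<open>G\<^sub>n\<close> reproduces polynomials of degree at most \<open>n\<close>,
  \<open>\<parallel>r\<parallel>\<^sup>2 = Q(p r) - I(p r)\<close>. The symmetric bilinear form \<open>Q(f g) - I(f g)\<close> is bounded by \<open>\<eta>\<close> on the
  diagonal by the MZ inequality, hence by polarization \<open>\<parallel>r\<parallel>\<^sup>2 \<le> \<eta> \<parallel>p\<parallel> \<parallel>r\<parallel>\<close>.

  The reproducing property is reduced by rotation to the kernel at the north pole. Infinitesimal
  rotation invariance of the surface measure gives recurrences that reduce every integral of
  \<open>y\<^sub>1\<^sup>a y\<^sub>2\<^sup>b h(y\<^sub>3)\<close> to integrals of polynomials in \<open>y\<^sub>3\<close>, each step producing a factor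
  \<open>1 - y\<^sub>3\<^sup>2\<close> that vanishes at the pole, and they also evaluate the latter integrals. Finally
  \<open>\<Sum>\<^bsub>l\<le>n\<^esub> (2l + 1) P\<^sub>l = (P\<^sub>n\<^sub>+\<^sub>1 + P\<^sub>n)'\<close>, and integration by parts leaves only the value at \<open>1\<close>.
\<close>

section \<open>Integration over the sphere\<close>

lemma finite_measure_surface_measure: "finite_measure surface_measure"
  by (rule finite_measureI)
    (simp add: space_surface_measure emeasure_surface_measure_S2)

lemma borel_measurable_surface_measure:
  fixes f :: "real ^ 3 \<Rightarrow> real"
  assumes "continuous_on S2 f"
  shows "f \<in> borel_measurable surface_measure"
  using borel_measurable_continuous_on_restrict[OF assms]
  by (simp cong: measurable_cong_sets add: sets_surface_measure)

lemma bounded_on_S2: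
  fixes f :: "real ^ 3 \<Rightarrow> real"
  assumes "continuous_on S2 f"
  obtains K where "\<And>x. x \<in> S2 \<Longrightarrow> \<bar>f x\<bar> \<le> K"
proof -
  have "bounded (f ` S2)"
    by (intro compact_imp_bounded compact_continuous_image assms compact_sphere)
  then show ?thesis
    using that by (auto simp: bounded_iff simp del: mem_sphere_0 mem_sphere)
qed

lemma integrable_surface_measure:
  fixes f :: "real ^ 3 \<Rightarrow> real"
  assumes "continuous_on S2 f"
  shows "integrable surface_measure f"
proof -
  obtain K where "\<And>x. x \<in> S2 \<Longrightarrow> \<bar>f x\<bar> \<le> K"
    using bounded_on_S2[OF assms] by blast
  then show ?thesis
    by (intro finite_measure.integrable_const_bound[OF finite_measure_surface_measure, where B = K]
        AE_I2 borel_measurable_surface_measure assms) (simp add: space_surface_measure)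
qed

lemma sphere_integral_cong:
  "(\<And>x. x \<in> S2 \<Longrightarrow> f x = g x) \<Longrightarrow> sphere_integral f = sphere_integral g"
  unfolding sphere_integral_def by (rule Bochner_Integration.integral_cong) (auto simp: space_surface_measure)

lemma sphere_integral_add:
  assumes "continuous_on S2 f" "continuous_on S2 g"
  shows "sphere_integral (\<lambda>x. f x + g x) = sphere_integral f + sphere_integral g"
  unfolding sphere_integral_def
  by (intro Bochner_Integration.integral_add integrable_surface_measure assms)

lemma sphere_integral_diff:
  assumes "continuous_on S2 f" "continuous_on S2 g"
  shows "sphere_integral (\<lambda>x. f x - g x) = sphere_integral f - sphere_integral g"
  unfolding sphere_integral_def
  by (intro Bochner_Integration.integral_diff integrable_surface_measure assms)

lemma sphere_integral_cmult: "sphere_integral (\<lambda>x. c * f x) = c * sphere_integral f"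
  unfolding sphere_integral_def by simp

lemma sphere_integral_sum:
  assumes "\<And>i. i \<in> I \<Longrightarrow> continuous_on S2 (f i)"
  shows "sphere_integral (\<lambda>x. \<Sum>i\<in>I. f i x) = (\<Sum>i\<in>I. sphere_integral (f i))"
  unfolding sphere_integral_def
  by (intro Bochner_Integration.integral_sum integrable_surface_measure assms)

lemma sphere_integral_nonneg: "(\<And>x. 0 \<le> f x) \<Longrightarrow> 0 \<le> sphere_integral f"
  unfolding sphere_integral_def by simp

lemma sphere_integral_const: "sphere_integral (\<lambda>_. c) = 4 * pi * c"
  by (simp add: sphere_integral_def measure_def space_surface_measure emeasure_surface_measure_S2)

text \<open>Preimages under \<open>T\<close> are images under \<open>inv T\<close>, so rotation
  invariance of the measure says that \<open>T\<close> pushes it forward to itself; the rest is the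
  transformation formula.\<close>

lemma sphere_integral_rotate:
  assumes T: "orthogonal_transformation T" and f: "continuous_on S2 f"
  shows "sphere_integral (\<lambda>x. f (T x)) = sphere_integral f"
proof -
  have T': "orthogonal_transformation (inv T)"
    using T by (rule orthogonal_transformation_inv)
  have bT: "bij T"
    using T by (rule orthogonal_transformation_bij)
  have n: "norm (T x) = norm x" "norm (inv T x) = norm x" for x
    using T T' by (simp_all add: orthogonal_transformation_norm)
  have pre: "T -` A \<inter> space surface_measure = inv T ` A" if "A \<in> sets surface_measure" for A
  proof -
    have "A \<subseteq> S2"
      using sets.sets_into_space[OF that] by (simp add: space_surface_measure)
    then have "T -` A \<subseteq> space surface_measure"
      using n(1) by (auto simp: space_surface_measure)
    then show ?thesis
      by (simp add: bij_vimage_eq_inv_image[OF bT] Int_absorb2)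
  qed
  have m: "T \<in> surface_measure \<rightarrow>\<^sub>M surface_measure"
  proof (rule measurableI)
    show "T x \<in> space surface_measure" if "x \<in> space surface_measure" for x
      using that by (simp add: space_surface_measure n)
    show "T -` A \<inter> space surface_measure \<in> sets surface_measure"
      if "A \<in> sets surface_measure" for A
      using surface_measure_rotation_invariant(1)[OF T' that] pre[OF that] by simp
  qed
  have "distr surface_measure surface_measure T = surface_measure"
  proof (rule measure_eqI)
    fix A assume "A \<in> sets (distr surface_measure surface_measure T)"
    then have A: "A \<in> sets surface_measure" by simp
    show "emeasure (distr surface_measure surface_measure T) A = emeasure surface_measure A"
      by (simp add: emeasure_distr[OF m A] pre[OF A] surface_measure_rotation_invariant(2)[OF T' A])
  qed simp
  then show ?thesis
    unfolding sphere_integral_def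
    using integral_distr[OF m borel_measurable_surface_measure[OF f]] by simp
qed

section \<open>Rotations in a plane and their generators\<close>

definition plane_rotation :: "'a::real_inner \<Rightarrow> 'a \<Rightarrow> real \<Rightarrow> 'a \<Rightarrow> 'a" where
  "plane_rotation u v t y =
     y + ((cos t - 1) * (u \<bullet> y) - sin t * (v \<bullet> y)) *\<^sub>R u
       + (sin t * (u \<bullet> y) + (cos t - 1) * (v \<bullet> y)) *\<^sub>R v"

text \<open>The map adds to \<open>y\<close> a correction in the span of \<open>u\<close> and
  \<open>v\<close>. It turns the coordinates \<open>(p, q)\<close> of \<open>y\<close> in that plane
  into \<open>(a + p, b + q)\<close>, which is \<open>(p, q)\<close> rotated by the angle
  \<open>t\<close>, and leaves the complementary part alone.\<close>

lemma orthogonal_transformation_plane_rotation: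
  fixes u v :: "'a::euclidean_space"
  assumes "norm u = 1" "norm v = 1" "u \<bullet> v = 0"
  shows "orthogonal_transformation (plane_rotation u v t)"
  unfolding orthogonal_transformation
proof (intro conjI allI)
  show "linear (plane_rotation u v t)"
    by (rule linearI) (simp_all add: plane_rotation_def algebra_simps)
  fix y
  define p q where pq: "p = u \<bullet> y" "q = v \<bullet> y"
  define a b where ab: "a = (cos t - 1) * p - sin t * q" "b = sin t * p + (cos t - 1) * q"
  have uv: "u \<bullet> u = 1" "v \<bullet> v = 1" "v \<bullet> u = 0"
    using assms by (simp_all add: norm_eq_1 inner_commute)
  have "plane_rotation u v t y \<bullet> plane_rotation u v t y
      = y \<bullet> y + a\<^sup>2 + b\<^sup>2 + 2 * a * p + 2 * b * q"
    unfolding plane_rotation_def pq[symmetric] ab[symmetric]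
    by (simp add: inner_simps uv assms(3) inner_commute[of y u] inner_commute[of y v] pq[symmetric] power2_eq_square algebra_simps)
  also have "\<dots> = y \<bullet> y + (a + p)\<^sup>2 + (b + q)\<^sup>2 - p\<^sup>2 - q\<^sup>2"
    by (simp add: power2_eq_square algebra_simps)
  also have "(a + p)\<^sup>2 + (b + q)\<^sup>2 = ((cos t)\<^sup>2 + (sin t)\<^sup>2) * (p\<^sup>2 + q\<^sup>2)"
    unfolding ab power2_eq_square by (simp only: algebra_simps)
  then have "y \<bullet> y + (a + p)\<^sup>2 + (b + q)\<^sup>2 - p\<^sup>2 - q\<^sup>2 = y \<bullet> y"
    by simp
  finally show "norm (plane_rotation u v t y) = norm y"
    by (simp add: norm_eq_sqrt_inner)
qed

lemma plane_rotation_0: "plane_rotation u v 0 y = y"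
  by (simp add: plane_rotation_def)

text \<open>The velocity is a fixed linear field evaluated at the current point \<open>R t\<close>,
  for every \<open>t\<close>. This gives derivatives of functions along the whole orbit, not only at
  its start.\<close>

lemma plane_rotation_has_vector_derivative:
  fixes u v y :: "'a::euclidean_space"
  assumes "norm u = 1" "norm v = 1" "u \<bullet> v = 0"
  defines "R \<equiv> \<lambda>t. plane_rotation u v t y"
  shows "(R has_vector_derivative ((u \<bullet> R t) *\<^sub>R v - (v \<bullet> R t) *\<^sub>R u)) (at t)"
proof -
  have uv: "u \<bullet> u = 1" "v \<bullet> v = 1" "v \<bullet> u = 0"
    using assms by (simp_all add: norm_eq_1 inner_commute)
  have R: "u \<bullet> R t = cos t * (u \<bullet> y) - sin t * (v \<bullet> y)" "v \<bullet> R t = sin t * (u \<bullet> y) + cos t * (v \<bullet> y)"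
    by (simp_all add: R_def plane_rotation_def inner_simps uv assms(3) algebra_simps)
  show ?thesis
    unfolding R unfolding R_def plane_rotation_def
    by (auto intro!: derivative_eq_intros simp: algebra_simps)
qed

text \<open>
  The generator \<open>g\<close> is the derivative of \<open>f\<close> along the rotation, and the integral of \<open>f\<close> does not
  change under the rotation.
\<close>

lemma sphere_integral_rotation_generator:
  fixes f :: "real ^ 3 \<Rightarrow> real" and u v :: "real ^ 3"
  assumes uv: "norm u = 1" "norm v = 1" "u \<bullet> v = 0"
    and f: "\<And>y. (f has_derivative f' y) (at y)"
    and g: "\<And>y. f' y ((u \<bullet> y) *\<^sub>R v - (v \<bullet> y) *\<^sub>R u) = g y"
    and cont: "continuous_on S2 g"
  shows "sphere_integral g = 0"
proof -
  let ?R = "plane_rotation u v"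
  have fc: "continuous_on S f" for S
    using f by (intro continuous_at_imp_continuous_on ballI has_derivative_continuous)
  have nR: "norm (?R t y) = norm y" for t y
    using orthogonal_transformation_plane_rotation[OF uv]
    by (simp add: orthogonal_transformation_norm)
  have Rc: "continuous_on S (?R t)" for S t
    using orthogonal_transformation_plane_rotation[OF uv, of t]
    by (simp add: linear_continuous_on linear_linear orthogonal_transformation_linear)
  have fRc: "continuous_on S (\<lambda>y. f (?R t y))" for S t
    by (rule continuous_on_compose2[OF fc[of UNIV] Rc]) simp
  have der: "((\<lambda>t. f (?R t y)) has_real_derivative g (?R t y)) (at t)" for t y
  proof -
    have "((\<lambda>t. f (?R t y)) has_vector_derivative
        f' (?R t y) ((u \<bullet> ?R t y) *\<^sub>R v - (v \<bullet> ?R t y) *\<^sub>R u)) (at t)"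
      using vector_derivative_diff_chain_within[OF plane_rotation_has_vector_derivative[OF uv, of y t]
          has_derivative_at_withinI[OF f]]
      by (simp add: o_def)
    then show ?thesis
      by (simp add: g has_real_derivative_iff_has_vector_derivative)
  qed
  obtain K where K: "\<And>x. x \<in> S2 \<Longrightarrow> \<bar>g x\<bar> \<le> K"
    using bounded_on_S2[OF cont] by blast
  define h where "h n = inverse (real (Suc n))" for n
  have h: "h n > 0" for n
    by (simp add: h_def)
  have h0: "h \<longlonglongrightarrow> 0"
    unfolding h_def by (rule LIMSEQ_inverse_real_of_nat)
  define D where "D n y = (f (?R (h n) y) - f y) / h n" for n y
  have Dc: "continuous_on S2 (D n)" for n
    unfolding D_def using h[of n]
    by (intro continuous_intros fc fRc ballI) simp
  have Dint: "sphere_integral (D n) = 0" for n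
  proof -
    have "sphere_integral (D n) = 1 / h n * sphere_integral (\<lambda>y. f (?R (h n) y) - f y)"
      unfolding sphere_integral_cmult[symmetric] D_def by simp
    also have "sphere_integral (\<lambda>y. f (?R (h n) y) - f y) = 0"
      by (simp add: sphere_integral_diff[OF fRc fc]
          sphere_integral_rotate[OF orthogonal_transformation_plane_rotation[OF uv] fc])
    finally show ?thesis by simp
  qed
  have Dlim: "(\<lambda>n. D n y) \<longlonglongrightarrow> g y" for y
  proof -
    have "((\<lambda>t. (f (?R t y) - f y) / t) \<longlongrightarrow> g y) (at 0)"
      using der[of y 0] by (simp add: has_field_derivative_iff plane_rotation_0)
    moreover have "filterlim h (at 0) sequentially"
      using h0 by (simp add: filterlim_at h_def)
    ultimately show ?thesis
      unfolding D_def by (rule filterlim_compose)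
  qed
  \<comment> \<open>By the mean value theorem the quotient is a value of \<open>g\<close> on the
    orbit of \<open>y\<close>, which stays on the sphere, so the bound of \<open>g\<close> there
    dominates every \<open>D n\<close>.\<close>
  have Dbound: "\<bar>D n y\<bar> \<le> K" if "y \<in> S2" for n y
  proof -
    obtain z where z: "f (?R (h n) y) - f (?R 0 y) = (h n - 0) * g (?R z y)"
      using MVT2[OF h[of n], of "\<lambda>t. f (?R t y)" "\<lambda>t. g (?R t y)"] der by auto
    have "D n y = g (?R z y)"
      using z h[of n] by (simp add: D_def plane_rotation_0)
    then show ?thesis
      using K[of "?R z y"] that by (simp add: nR)
  qed
  have "(\<lambda>n. sphere_integral (D n)) \<longlonglongrightarrow> sphere_integral g"
    unfolding sphere_integral_def
  proof (rule integral_dominated_convergence[where w = "\<lambda>_. K"])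
    show "integrable surface_measure (\<lambda>_. K)"
      by (intro integrable_surface_measure continuous_intros)
    show "g \<in> borel_measurable surface_measure" "\<And>n. D n \<in> borel_measurable surface_measure"
      by (intro borel_measurable_surface_measure cont Dc)+
    show "AE y in surface_measure. (\<lambda>n. D n y) \<longlonglongrightarrow> g y"
      by (intro AE_I2 Dlim)
    show "AE y in surface_measure. norm (D n y) \<le> K" for n
      by (intro AE_I2) (simp add: Dbound space_surface_measure)
  qed
  then show ?thesis
    by (simp add: Dint LIMSEQ_const_iff)
qed

section \<open>Moments of the surface measure\<close>

text \<open>The first two coordinates enter as monomials and the third through a polynomial, since a
  kernel centred at the pole depends on \<open>y $ 3\<close> alone.\<close>

definition sphere_moment :: "nat \<Rightarrow> nat \<Rightarrow> real poly \<Rightarrow> real" where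
  "sphere_moment a b h = sphere_integral (\<lambda>y. (y $ 1) ^ a * (y $ 2) ^ b * poly h (y $ 3))"

lemma continuous_on_sphere_moment:
  "continuous_on S (\<lambda>y :: real ^ 3. (y $ 1) ^ a * (y $ 2) ^ b * poly h (y $ 3))"
  by (intro continuous_intros)

lemma sphere_moment_add: "sphere_moment a b (p + q) = sphere_moment a b p + sphere_moment a b q"
  unfolding sphere_moment_def
  by (simp add: sphere_integral_add[symmetric] continuous_on_sphere_moment ring_distribs)

lemma sphere_moment_smult: "sphere_moment a b (smult c p) = c * sphere_moment a b p"
  unfolding sphere_moment_def sphere_integral_cmult[symmetric] by (simp add: algebra_simps)

lemma sphere_moment_0: "sphere_moment a b 0 = 0"
  using sphere_moment_smult[of a b 0 0] by simp

lemma sphere_moment_diff: "sphere_moment a b (p - q) = sphere_moment a b p - sphere_moment a b q"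
  using sphere_moment_add[of a b "p - q" q] by simp

lemma S2_sum_squares: "y \<in> S2 \<Longrightarrow> (y $ 1)\<^sup>2 + (y $ 2)\<^sup>2 + (y $ 3)\<^sup>2 = 1"
  by (simp add: norm_eq_1 inner_vec_def sum_3 power2_eq_square)

text \<open>
  For \<open>a = 0\<close> or \<open>b = 0\<close> the truncated exponent is harmless: it has the coefficient \<open>0\<close>.
\<close>

lemma sphere_moment_rotate_12:
  "real b * sphere_moment (a + 1) (b - 1) h = real a * sphere_moment (a - 1) (b + 1) h"
proof -
  \<comment> \<open>\<open>g\<close> is the derivative of \<open>f\<close> along the rotation of the
    first two coordinates. This rotation fixes \<open>y $ 3\<close>, so the term with
    \<open>pderiv h\<close> drops out.\<close>
  define g where "g = (\<lambda>y :: real ^ 3.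
      real b * ((y $ 1) ^ (a + 1) * (y $ 2) ^ (b - 1) * poly h (y $ 3))
    - real a * ((y $ 1) ^ (a - 1) * (y $ 2) ^ (b + 1) * poly h (y $ 3)))"
  define f where "f = (\<lambda>y :: real ^ 3. (y $ 1) ^ a * (y $ 2) ^ b * poly h (y $ 3))"
  define f' where "f' = (\<lambda>(y :: real ^ 3) (v :: real ^ 3).
      real a * (y $ 1) ^ (a - 1) * v $ 1 * ((y $ 2) ^ b * poly h (y $ 3))
    + real b * (y $ 2) ^ (b - 1) * v $ 2 * ((y $ 1) ^ a * poly h (y $ 3))
    + poly (pderiv h) (y $ 3) * v $ 3 * ((y $ 1) ^ a * (y $ 2) ^ b))"
  have "(f has_derivative f' y) (at y)" for y
    unfolding f_def f'_def
    by (rule derivative_eq_intros bounded_linear_imp_has_derivative bounded_linear_vec_nth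
        poly_DERIV[THEN DERIV_compose_FDERIV] refl)+
      (simp add: fun_eq_iff algebra_simps)
  moreover have "f' y ((axis 1 1 \<bullet> y) *\<^sub>R axis 2 1 - (axis 2 1 \<bullet> y) *\<^sub>R axis 1 1) = g y" for y
    unfolding inner_axis' by (simp add: f'_def g_def axis_def algebra_simps)
  ultimately have "sphere_integral g = 0"
    by (intro sphere_integral_rotation_generator[of "axis 1 1" "axis 2 1" f f'])
      (auto simp: g_def inner_axis_axis intro!: continuous_intros)
  then show ?thesis
    unfolding g_def sphere_moment_def sphere_integral_cmult[symmetric]
    by (subst (asm) sphere_integral_diff) (auto intro!: continuous_intros)
qed

text \<open>Infinitesimal rotation in the plane of the axes 3 and 1 is applied to
  \<open>y $ 1 * poly h (y $ 3)\<close>. This is the relation that brings in the derivative of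
  \<open>h\<close>.\<close>

lemma sphere_moment_rotate_31: "sphere_moment 2 0 (pderiv h) = sphere_moment 0 0 ([:0, 1:] * h)"
proof -
  define g where "g = (\<lambda>y :: real ^ 3. y $ 3 * poly h (y $ 3) - (y $ 1)\<^sup>2 * poly (pderiv h) (y $ 3))"
  define f where "f = (\<lambda>y :: real ^ 3. y $ 1 * poly h (y $ 3))"
  define f' where "f' = (\<lambda>(y :: real ^ 3) (v :: real ^ 3).
    v $ 1 * poly h (y $ 3) + y $ 1 * (poly (pderiv h) (y $ 3) * v $ 3))"
  have "(f has_derivative f' y) (at y)" for y
    unfolding f_def f'_def
    by (rule derivative_eq_intros bounded_linear_imp_has_derivative bounded_linear_vec_nth
        poly_DERIV[THEN DERIV_compose_FDERIV] refl)+
      (simp add: fun_eq_iff algebra_simps)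
  moreover have "f' y ((axis 3 1 \<bullet> y) *\<^sub>R axis 1 1 - (axis 1 1 \<bullet> y) *\<^sub>R axis 3 1) = g y" for y
    unfolding inner_axis' by (simp add: f'_def g_def axis_def algebra_simps power2_eq_square)
  ultimately have "sphere_integral g = 0"
    by (intro sphere_integral_rotation_generator[of "axis 3 1" "axis 1 1" f f'])
      (auto simp: g_def inner_axis_axis intro!: continuous_intros)
  then show ?thesis
    unfolding g_def sphere_moment_def
    by (subst (asm) sphere_integral_diff) (auto intro!: continuous_intros)
qed

text \<open>On the sphere the first two squares add up to the value of \<open>[:1, 0, -1:]\<close>
  at \<open>y $ 3\<close>.\<close>

lemma sphere_moment_sphere:
  "sphere_moment (a + 2) b h + sphere_moment a (b + 2) h = sphere_moment a b ([:1, 0, -1:] * h)"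
proof -
  have "(y $ 1) ^ (a + 2) * (y $ 2) ^ b * poly h (y $ 3) + (y $ 1) ^ a * (y $ 2) ^ (b + 2) * poly h (y $ 3)
      = (y $ 1) ^ a * (y $ 2) ^ b * poly ([:1, 0, -1:] * h) (y $ 3)" if "y \<in> S2" for y
  proof -
    have "poly [:1, 0, -1:] (y $ 3) = (y $ 1)\<^sup>2 + (y $ 2)\<^sup>2"
      using S2_sum_squares[OF that] by (simp add: power2_eq_square)
    then show ?thesis
      unfolding poly_mult by (simp only: power_add) (simp add: algebra_simps)
  qed
  then show ?thesis
    unfolding sphere_moment_def
    by (subst sphere_integral_add[symmetric])
      (intro continuous_on_sphere_moment sphere_integral_cong, assumption?)+
qed

text \<open>The rotation recurrence fixes the ratio of the two raised moments and the equation of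
  the sphere fixes their sum; the two relations are solved for each moment.\<close>

lemma sphere_moment_reduce:
  "(real a + real b + 2) * sphere_moment (a + 2) b h
    = (real a + 1) * sphere_moment a b ([:1, 0, -1:] * h)"
  "(real a + real b + 2) * sphere_moment a (b + 2) h
    = (real b + 1) * sphere_moment a b ([:1, 0, -1:] * h)"
proof -
  have "(real b + 1) * sphere_moment (a + 2) b h = (real a + 1) * sphere_moment a (b + 2) h"
    using sphere_moment_rotate_12[of "b + 1" "a + 1" h] by (simp add: add.commute)
  then show "(real a + real b + 2) * sphere_moment (a + 2) b h
      = (real a + 1) * sphere_moment a b ([:1, 0, -1:] * h)"
    "(real a + real b + 2) * sphere_moment a (b + 2) h
      = (real b + 1) * sphere_moment a b ([:1, 0, -1:] * h)"
    unfolding sphere_moment_sphere[symmetric] by (simp_all only: algebra_simps)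
qed

text \<open>One side of the rotation recurrence vanishes when one exponent is 0. This settles the
  odd exponents at the bottom of the reduction.\<close>

lemma sphere_moment_1: "sphere_moment 1 b h = 0" "sphere_moment a 1 h = 0"
  using sphere_moment_rotate_12[of "b + 1" 0 h] sphere_moment_rotate_12[of 0 "a + 1" h] by simp_all

text \<open>
  Archimedes' theorem that the height \<open>y $ 3\<close> is uniformly distributed on \<open>[-1, 1]\<close>, for polynomials.
\<close>

lemma sphere_moment_pderiv:
  "sphere_moment 0 0 (pderiv p) = 2 * pi * (poly p 1 - poly p (-1))"
proof -
  \<comment> \<open>Division by \<open>x^2 - 1\<close>: the multiple of it vanishes at both end
    points and will integrate to nothing, so only the slope \<open>d\<close> of the linear remainder
    matters.\<close>
  define h r where "h = p div [:-1, 0, 1:]" and "r = p mod [:-1, 0, 1:]"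
  have "degree r < 2"
    using degree_mod_less[of "[:-1, 0, 1 :: real:]" p] by (auto simp: r_def)
  then obtain c d where r: "r = [:c, d:]"
    by (metis degree_eq_zeroE degree1_coeffs less_2_cases One_nat_def pCons_0_0)
  have p: "p = [:-1, 0, 1:] * h + r"
    unfolding h_def r_def by (rule mult_div_mod_eq[symmetric])
  \<comment> \<open>The moment \<open>sphere_moment 2 0 (pderiv h)\<close> is evaluated in two ways,
    by reduction and by rotation. The outcome is that the derivative of \<open>(x^2 - 1) * h\<close>
    integrates to 0.\<close>
  have "2 * sphere_moment 0 0 ([:0, 1:] * h) = sphere_moment 0 0 ([:1, 0, -1:] * pderiv h)"
    using sphere_moment_reduce(1)[of 0 0 "pderiv h"] sphere_moment_rotate_31[of h]
    by (simp add: numeral_2_eq_2)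
  then have "sphere_moment 0 0 (smult 2 ([:0, 1:] * h) - [:1, 0, -1:] * pderiv h) = 0"
    by (simp only: sphere_moment_diff sphere_moment_smult)
  also have "smult 2 ([:0, 1:] * h) - [:1, 0, -1:] * pderiv h = pderiv ([:-1, 0, 1:] * h)"
    unfolding pderiv_mult by (simp add: pderiv_pCons algebra_simps)
  finally have "sphere_moment 0 0 (pderiv p) = sphere_moment 0 0 [:d:]"
    unfolding p r pderiv_add sphere_moment_add by (simp add: pderiv_pCons)
  also have "\<dots> = 4 * pi * d"
    by (simp add: sphere_moment_def sphere_integral_const)
  also have "\<dots> = 2 * pi * (poly p 1 - poly p (-1))"
    by (simp add: p r)
  finally show ?thesis .
qed

text \<open>Each reduction trades two powers of \<open>y $ 1\<close> or \<open>y $ 2\<close> for a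
  factor \<open>1 - x^2\<close> in \<open>h\<close>, which respects the degree bound and vanishes at
  1. The factor \<open>0 ^ (a + b)\<close> is the value of the monomial in the first two coordinates
  at the pole, with \<open>0 ^ 0 = 1\<close>.\<close>

lemma sphere_moment_kernel:
  assumes K: "\<And>h. degree h \<le> n \<Longrightarrow> sphere_moment 0 0 (h * K) = poly h 1"
  assumes "a + b + degree h \<le> n"
  shows "sphere_moment a b (h * K) = 0 ^ (a + b) * poly h 1"
  using assms(2)
proof (induction "a + b" arbitrary: a b h rule: less_induct)
  case less
  have deg: "degree ([:1, 0, -1:] * h) \<le> degree h + 2"
    using degree_mult_le[of "[:1, 0, -1:]" h] by simp
  consider "a = 0" "b = 0" | "a = 1" | "b = 1" | a' where "a = a' + 2" | b' where "b = b' + 2"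
    by (metis One_nat_def add_2_eq_Suc' not0_implies_Suc)
  then show ?case
  proof cases
    case 1
    then show ?thesis using K less.prems by simp
  next
    case 2
    then show ?thesis by (simp add: sphere_moment_1(1)[simplified])
  next
    case 3
    then show ?thesis by (simp add: sphere_moment_1(2)[simplified])
  next
    case (4 a')
    have "sphere_moment a' b (([:1, 0, -1:] * h) * K) = 0"
      using less.hyps[of a' b "[:1, 0, -1:] * h"] less.prems deg 4 by simp
    then have "(real a' + real b + 2) * sphere_moment a b (h * K) = 0"
      unfolding 4 sphere_moment_reduce(1) by (simp only: mult.assoc mult_zero_right)
    then show ?thesis
      by (simp add: 4 add_eq_0_iff_both_eq_0)
  next
    case (5 b')
    have "sphere_moment a b' (([:1, 0, -1:] * h) * K) = 0"
      using less.hyps[of a b' "[:1, 0, -1:] * h"] less.prems deg 5 by simp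
    then have "(real a + real b' + 2) * sphere_moment a b (h * K) = 0"
      unfolding 5 sphere_moment_reduce(2) by (simp only: mult.assoc mult_zero_right)
    then show ?thesis
      by (simp add: 5 add_eq_0_iff_both_eq_0)
  qed
qed

section \<open>Legendre polynomials\<close>

text \<open>In Rodrigues' formula the \<open>l\<close> derivatives at -1 consume the factor
  \<open>(x + 1)^l\<close>, and the cofactor \<open>(x - 1)^l\<close> contributes
  \<open>(-2) ^ l\<close>.\<close>

lemma legendre_poly_minus_1: "poly (legendre_poly l) (-1) = (-1) ^ l"
proof -
  have "[:-1, 0, 1 :: real:] = [:- (- 1), 1:] * [:-1, 1:]"
    by simp
  then have "[:-1, 0, 1 :: real:] ^ l = [:- (- 1), 1:] ^ l * [:-1, 1:] ^ l"
    by (metis power_mult_distrib)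
  then have "poly (legendre_poly l) (-1) = (-2) ^ l / 2 ^ l"
    by (simp only: legendre_poly_def poly_smult higher_pderiv_linear_power)
      (simp add: poly_power)
  then show ?thesis
    by (simp add: power_divide[symmetric])
qed

text \<open>With \<open>u = x^2 - 1\<close>, the second derivative of \<open>u ^ (l + 2)\<close> is
  a combination of \<open>u ^ (l + 1)\<close> and \<open>u ^ l\<close>; Rodrigues' formula turns
  this into the classical identity \<open>(2 k + 1) P_k = P'_(k+1) - P'_(k-1)\<close> at
  \<open>k = l + 1\<close>.\<close>

lemma pderiv_legendre_poly_Suc_Suc:
  "pderiv (legendre_poly (l + 2)) = smult (2 * real l + 3) (legendre_poly (l + 1)) + pderiv (legendre_poly l)"
proof -
  define u :: "real poly" where "u = [:-1, 0, 1:]"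
  define m where "m = real l + 1"
  define x :: "real poly" where "x = [:0, 1:]"
  have du: "pderiv u = smult 2 x" and dx: "pderiv x = 1" and xx: "x * x = u + 1"
    by (simp_all add: u_def x_def pderiv_pCons one_pCons)
  have "pderiv (pderiv (u ^ (l + 2))) = smult (2 * (m + 1)) (pderiv (x * u ^ (l + 1)))"
    by (simp add: pderiv_power_Suc du m_def pderiv_smult[symmetric] algebra_simps del: power_Suc)
  also have "pderiv (x * u ^ (l + 1)) = u ^ (l + 1) + smult (2 * m) ((x * x) * u ^ l)"
    by (simp add: pderiv_mult pderiv_power_Suc du dx m_def algebra_simps del: power_Suc)
  also have "\<dots> = smult (2 * m + 1) (u ^ (l + 1)) + smult (2 * m) (u ^ l)"
    unfolding xx by (simp add: algebra_simps smult_add_left smult_add_right)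
  finally have D2: "pderiv (pderiv (u ^ (l + 2)))
      = smult (2 * (m + 1) * (2 * m + 1)) (u ^ (l + 1)) + smult (4 * m * (m + 1)) (u ^ l)"
    by (simp add: smult_add_right algebra_simps)
  \<comment> \<open>Of the \<open>l + 3\<close> derivatives two are carried out in
    \<open>D2\<close>. The other \<open>l + 1\<close> are the right number for
    \<open>u ^ (l + 1)\<close> and one too many for \<open>u ^ l\<close>, whence the outer
    \<open>pderiv\<close> in the last term.\<close>
  have "(pderiv ^^ (l + 3)) (u ^ (l + 2)) = (pderiv ^^ (l + 1)) (pderiv (pderiv (u ^ (l + 2))))"
    by (simp add: funpow_Suc_right numeral_3_eq_3 del: funpow.simps)
  also have "\<dots> = smult (2 * (m + 1) * (2 * m + 1)) ((pderiv ^^ (l + 1)) (u ^ (l + 1)))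
      + smult (4 * m * (m + 1)) (pderiv ((pderiv ^^ l) (u ^ l)))"
    unfolding D2 higher_pderiv_add higher_pderiv_smult by simp
  finally have *: "pderiv ((pderiv ^^ (l + 2)) (u ^ (l + 2))) = \<dots>"
    by (simp add: numeral_3_eq_3 numeral_2_eq_2)
  have c: "1 / (2 ^ (l + 2) * fact (l + 2)) = 1 / (2 ^ l * fact l) / (4 * m * (m + 1))"
      "1 / (2 ^ (l + 1) * fact (l + 1)) = 1 / (2 ^ l * fact l) / (2 * m)"
    by (simp_all add: m_def field_simps)
  have m: "m > 0" by (simp add: m_def)
  have l: "2 * real l + 3 = 2 * m + 1" by (simp add: m_def)
  \<comment> \<open>\<open>k\<close> stands for \<open>1 / (2 ^ l * fact l)\<close>, the part common
    to all three normalisations.\<close>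
  have "k / (4 * m * (m + 1)) * (2 * (m + 1) * (2 * m + 1)) = (2 * m + 1) * (k / (2 * m))"
      "k / (4 * m * (m + 1)) * (4 * m * (m + 1)) = k" for k :: real
    using m by (auto simp: divide_simps) (simp add: algebra_simps)
  then show ?thesis
    unfolding legendre_poly_def u_def[symmetric] pderiv_smult * c l
    by (simp only: smult_add_right smult_smult)
qed

text \<open>The recurrence jumps by two indices, so telescoping leaves two top terms. This makes the
  kernel an exact derivative, ready for integration by parts.\<close>

lemma sum_legendre_poly:
  "(\<Sum>l\<le>n. smult (2 * real l + 1) (legendre_poly l))
    = pderiv (legendre_poly (n + 1) + legendre_poly n)"
proof (induction n)
  case 0
  show ?case
    by (simp add: legendre_poly_def pderiv_pCons one_pCons pderiv_add)
next
  case (Suc n)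
  then show ?case
    using pderiv_legendre_poly_Suc_Suc[of n] by (simp add: pderiv_add algebra_simps)
qed

text \<open>When only \<open>k\<close> of the \<open>l\<close> linear factors are split off,
  \<open>k\<close> derivatives at \<open>a\<close> leave \<open>fact k\<close> times the cofactor,
  which still has the root \<open>a\<close>.\<close>

lemma poly_higher_pderiv_eq_0:
  fixes a :: real
  assumes "k < l" "[:-a, 1:] ^ l dvd p"
  shows "poly ((pderiv ^^ k) p) a = 0"
proof -
  obtain q where "p = [:-a, 1:] ^ l * q"
    using assms(2) by (rule dvdE)
  moreover have "[:-a, 1:] ^ l = [:-a, 1:] ^ k * [:-a, 1:] ^ (l - k)"
    using assms(1) by (simp flip: power_add)
  ultimately have "p = [:-a, 1:] ^ k * ([:-a, 1:] ^ (l - k) * q)"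
    by (simp only: mult.assoc)
  then show ?thesis
    using assms(1) by (simp only: higher_pderiv_linear_power) (simp add: poly_power)
qed

lemma sphere_moment_by_parts:
  assumes "poly p 1 = 0" "poly p (-1) = 0"
  shows "sphere_moment 0 0 (q * pderiv p) = - sphere_moment 0 0 (pderiv q * p)"
  using sphere_moment_pderiv[of "q * p"] assms
  by (simp add: pderiv_mult sphere_moment_add mult.commute)

text \<open>By Rodrigues' formula the derivatives can be moved one by one onto \<open>q\<close>,
  which they annihilate. No boundary terms arise, since fewer than \<open>l\<close> derivatives of
  \<open>u\<close> keep the roots 1 and -1.\<close>

lemma sphere_moment_legendre_poly:
  assumes "degree q < l"
  shows "sphere_moment 0 0 (q * legendre_poly l) = 0"
proof -
  define u :: "real poly" where "u = [:-1, 0, 1:] ^ l"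
  have u: "u = [:-1, 1:] ^ l * [:- (-1), 1:] ^ l"
    unfolding u_def power_mult_distrib[symmetric] by simp
  \<comment> \<open>The exponent in \<open>u\<close> stays fixed while the number \<open>k\<close>
    of derivatives varies. The degree bound becomes \<open>(pderiv ^^ k) q = 0\<close>, which passes
    to \<open>pderiv q\<close> with \<open>k\<close> lowered by one.\<close>
  have "sphere_moment 0 0 (q * (pderiv ^^ k) u) = 0" if "(pderiv ^^ k) q = 0" "k \<le> l" for k
    using that
  proof (induction k arbitrary: q)
    case (Suc k)
    have ends: "poly ((pderiv ^^ k) u) 1 = 0" "poly ((pderiv ^^ k) u) (-1) = 0"
      using Suc.prems(2) by (auto intro!: poly_higher_pderiv_eq_0[of k l] simp: u)
    have "sphere_moment 0 0 (pderiv q * (pderiv ^^ k) u) = 0"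
      using Suc.prems by (intro Suc.IH) (simp_all add: funpow_swap1)
    then show ?case
      by (simp add: sphere_moment_by_parts[OF ends])
  qed (simp add: sphere_moment_0)
  moreover have "(pderiv ^^ l) q = 0"
    using assms by (intro poly_eqI) (simp add: coeff_higher_pderiv coeff_eq_0)
  ultimately show ?thesis
    by (simp add: legendre_poly_def u_def sphere_moment_smult)
qed

section \<open>Spherical polynomials\<close>

lemma spherical_polynomials_cong:
  "f \<in> spherical_polynomials n \<Longrightarrow> (\<And>x. x \<in> S2 \<Longrightarrow> g x = f x) \<Longrightarrow> g \<in> spherical_polynomials n"
  unfolding spherical_polynomials_def by (simp del: mem_sphere_0 mem_sphere)

lemma spherical_polynomials_add:
  assumes "f \<in> spherical_polynomials n" "g \<in> spherical_polynomials n"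
  shows "(\<lambda>x. f x + g x) \<in> spherical_polynomials n"
proof -
  obtain c where c: "\<forall>x\<in>S2. f x
      = (\<Sum>(i, j, k) | i + j + k \<le> n. c i j k * (x $ 1) ^ i * (x $ 2) ^ j * (x $ 3) ^ k)"
    using assms(1) unfolding spherical_polynomials_def by blast
  obtain d where d: "\<forall>x\<in>S2. g x
      = (\<Sum>(i, j, k) | i + j + k \<le> n. d i j k * (x $ 1) ^ i * (x $ 2) ^ j * (x $ 3) ^ k)"
    using assms(2) unfolding spherical_polynomials_def by blast
  show ?thesis
    unfolding spherical_polynomials_def mem_Collect_eq using c d
    by (intro exI[of _ "\<lambda>i j k. c i j k + d i j k"])
      (simp add: sum.distrib[symmetric] case_prod_unfold ring_distribs del: mem_sphere_0 mem_sphere)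
qed

lemma spherical_polynomials_cmult:
  assumes "f \<in> spherical_polynomials n"
  shows "(\<lambda>x. a * f x) \<in> spherical_polynomials n"
proof -
  obtain c where c: "\<forall>x\<in>S2. f x
      = (\<Sum>(i, j, k) | i + j + k \<le> n. c i j k * (x $ 1) ^ i * (x $ 2) ^ j * (x $ 3) ^ k)"
    using assms(1) unfolding spherical_polynomials_def by blast
  show ?thesis
    unfolding spherical_polynomials_def mem_Collect_eq using c
    by (intro exI[of _ "\<lambda>i j k. a * c i j k"])
      (simp add: sum_distrib_left case_prod_unfold mult.assoc del: mem_sphere_0 mem_sphere)
qed

lemma spherical_polynomials_diff:
  "f \<in> spherical_polynomials n \<Longrightarrow> g \<in> spherical_polynomials n
    \<Longrightarrow> (\<lambda>x. f x - g x) \<in> spherical_polynomials n"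
  using spherical_polynomials_add[of f n "\<lambda>x. (-1) * g x"] spherical_polynomials_cmult[of g n "-1"]
  by simp

lemma spherical_polynomials_monomial:
  assumes "i + j + k \<le> n"
  shows "(\<lambda>x. (x $ 1) ^ i * (x $ 2) ^ j * (x $ 3) ^ k) \<in> spherical_polynomials n"
proof -
  define c :: "nat \<Rightarrow> nat \<Rightarrow> nat \<Rightarrow> real"
    where "c = (\<lambda>i' j' k'. if (i', j', k') = (i, j, k) then 1 else 0)"
  have "(x $ 1) ^ i * (x $ 2) ^ j * (x $ 3) ^ k
      = (\<Sum>(i', j', k') | i' + j' + k' \<le> n. c i' j' k' * (x $ 1) ^ i' * (x $ 2) ^ j' * (x $ 3) ^ k')"
    for x :: "real ^ 3"
  proof -
    have "(\<Sum>(i', j', k') | i' + j' + k' \<le> n. c i' j' k' * (x $ 1) ^ i' * (x $ 2) ^ j' * (x $ 3) ^ k')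
        = (\<Sum>q\<in>{(i, j, k). i + j + k \<le> n}. if q = (i, j, k)
            then (x $ 1) ^ i * (x $ 2) ^ j * (x $ 3) ^ k else 0)"
      by (intro sum.cong) (auto simp: c_def split: if_splits)
    then show ?thesis
      using assms by (simp add: finite_exponents_le)
  qed
  then show ?thesis
    unfolding spherical_polynomials_def by blast
qed

lemma spherical_polynomials_const: "(\<lambda>_. a) \<in> spherical_polynomials n"
  using spherical_polynomials_cmult[OF spherical_polynomials_monomial[of 0 0 0 n], of a] by simp

lemma spherical_polynomials_sum:
  "(\<And>i. i \<in> I \<Longrightarrow> f i \<in> spherical_polynomials n)
    \<Longrightarrow> (\<lambda>x. \<Sum>i\<in>I. f i x) \<in> spherical_polynomials n"
  by (induction I rule: infinite_finite_induct)
    (auto intro: spherical_polynomials_const spherical_polynomials_add)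

lemma spherical_polynomials_expand:
  assumes "f \<in> spherical_polynomials n"
  obtains c where "\<And>x. x \<in> S2 \<Longrightarrow> f x
    = (\<Sum>q\<in>{(i, j, k). i + j + k \<le> n}.
        c q * ((x $ 1) ^ fst q * (x $ 2) ^ fst (snd q) * (x $ 3) ^ snd (snd q)))"
proof -
  obtain c where "\<forall>x\<in>S2. f x
      = (\<Sum>(i, j, k) | i + j + k \<le> n. c i j k * (x $ 1) ^ i * (x $ 2) ^ j * (x $ 3) ^ k)"
    using assms(1) unfolding spherical_polynomials_def by blast
  then show ?thesis
    by (intro that[of "\<lambda>q. c (fst q) (fst (snd q)) (snd (snd q))"])
      (simp add: case_prod_unfold mult.assoc del: mem_sphere_0 mem_sphere)
qed

lemma continuous_on_spherical_polynomials:
  assumes "f \<in> spherical_polynomials n"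
  shows "continuous_on S2 f"
proof -
  obtain c where c: "\<And>x. x \<in> S2 \<Longrightarrow> f x
    = (\<Sum>q\<in>{(i, j, k). i + j + k \<le> n}.
        c q * ((x $ 1) ^ fst q * (x $ 2) ^ fst (snd q) * (x $ 3) ^ snd (snd q)))"
    using spherical_polynomials_expand[OF assms] by blast
  show ?thesis
    by (subst continuous_on_cong[OF refl c]) (auto intro!: continuous_intros)
qed

text \<open>By linearity it suffices to treat monomials. The weight \<open>g\<close> and the
  substitution \<open>T\<close> serve multiplication by a linear form, raising of the degree bound
  and composition with an orthogonal map.\<close>

lemma spherical_polynomials_map:
  assumes T: "T ` S2 \<subseteq> S2"
    and m: "\<And>i j k. i + j + k \<le> n \<Longrightarrow>
      (\<lambda>x. g x * ((T x $ 1) ^ i * (T x $ 2) ^ j * (T x $ 3) ^ k)) \<in> spherical_polynomials m"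
    and f: "f \<in> spherical_polynomials n"
  shows "(\<lambda>x. g x * f (T x)) \<in> spherical_polynomials m"
proof -
  obtain c where c: "\<And>x. x \<in> S2 \<Longrightarrow> f x
    = (\<Sum>q\<in>{(i, j, k). i + j + k \<le> n}.
        c q * ((x $ 1) ^ fst q * (x $ 2) ^ fst (snd q) * (x $ 3) ^ snd (snd q)))"
    using spherical_polynomials_expand[OF f] by blast
  show ?thesis
  proof (rule spherical_polynomials_cong)
    show "(\<lambda>x. \<Sum>q\<in>{(i, j, k). i + j + k \<le> n}.
        c q * (g x * ((T x $ 1) ^ fst q * (T x $ 2) ^ fst (snd q) * (T x $ 3) ^ snd (snd q))))
      \<in> spherical_polynomials m"
      by (intro spherical_polynomials_sum spherical_polynomials_cmult m) auto
    fix x assume "x \<in> S2"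
    then have "T x \<in> S2" using T by blast
    then show "g x * f (T x) = (\<Sum>q\<in>{(i, j, k). i + j + k \<le> n}.
        c q * (g x * ((T x $ 1) ^ fst q * (T x $ 2) ^ fst (snd q) * (T x $ 3) ^ snd (snd q))))"
      by (subst c) (simp_all only: sum_distrib_left mult.left_commute)
  qed
qed

lemma spherical_polynomials_mult_inner:
  assumes "f \<in> spherical_polynomials n"
  shows "(\<lambda>x. (v \<bullet> x) * f x) \<in> spherical_polynomials (Suc n)"
proof (rule spherical_polynomials_map[where T = "\<lambda>x. x", OF _ _ assms])
  fix i j k :: nat assume ijk: "i + j + k \<le> n"
  have "(\<lambda>x. v $ 1 * ((x $ 1) ^ Suc i * (x $ 2) ^ j * (x $ 3) ^ k)
      + v $ 2 * ((x $ 1) ^ i * (x $ 2) ^ Suc j * (x $ 3) ^ k)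
      + v $ 3 * ((x $ 1) ^ i * (x $ 2) ^ j * (x $ 3) ^ Suc k)) \<in> spherical_polynomials (Suc n)"
    using ijk by (intro spherical_polynomials_add spherical_polynomials_cmult
        spherical_polynomials_monomial) auto
  then show "(\<lambda>x. (v \<bullet> x) * ((x $ 1) ^ i * (x $ 2) ^ j * (x $ 3) ^ k)) \<in> spherical_polynomials (Suc n)"
    by (rule spherical_polynomials_cong) (simp add: inner_vec_def sum_3 algebra_simps)
qed simp

lemma spherical_polynomials_mult_power:
  assumes "f \<in> spherical_polynomials n"
  shows "(\<lambda>x. (v \<bullet> x) ^ k * f x) \<in> spherical_polynomials (k + n)"
proof (induction k)
  case (Suc k)
  then show ?case
    using spherical_polynomials_mult_inner[OF Suc, of v] by (simp add: mult.assoc)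
qed (use assms in simp)

lemma spherical_polynomials_mono:
  assumes "f \<in> spherical_polynomials m" "m \<le> n"
  shows "f \<in> spherical_polynomials n"
  using spherical_polynomials_map[of "\<lambda>x. x" m "\<lambda>_. 1" n f] assms
  by (simp add: spherical_polynomials_monomial)

lemma spherical_polynomials_poly_inner:
  assumes "degree q \<le> n"
  shows "(\<lambda>x. poly q (v \<bullet> x)) \<in> spherical_polynomials n"
  unfolding poly_altdef using assms
  by (intro spherical_polynomials_sum spherical_polynomials_cmult)
    (auto intro: spherical_polynomials_mono[OF spherical_polynomials_mult_power[
          OF spherical_polynomials_const[of 1 0], simplified]])

text \<open>Each coordinate of \<open>T x\<close> is the inner product of \<open>x\<close> with a
  fixed vector, so a monomial in \<open>T x\<close> is a product of linear forms and the degree does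
  not rise.\<close>

lemma spherical_polynomials_orthogonal_transformation:
  assumes T: "orthogonal_transformation T" and f: "f \<in> spherical_polynomials n"
  shows "(\<lambda>x. f (T x)) \<in> spherical_polynomials n"
proof -
  have Tm: "T x $ m = adjoint T (axis m 1) \<bullet> x" for x m
    using adjoint_clauses(2)[OF orthogonal_transformation_linear[OF T], of "axis m 1" x]
    by (simp add: inner_axis')
  have "(\<lambda>x. 1 * f (T x)) \<in> spherical_polynomials n"
  proof (rule spherical_polynomials_map[OF _ _ f])
    show "T ` S2 \<subseteq> S2"
      using T by (auto simp: orthogonal_transformation)
    fix i j k :: nat assume "i + j + k \<le> n"
    then show "(\<lambda>x. 1 * ((T x $ 1) ^ i * (T x $ 2) ^ j * (T x $ 3) ^ k)) \<in> spherical_polynomials n"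
      unfolding Tm
      using spherical_polynomials_mono[OF spherical_polynomials_mult_power[OF
            spherical_polynomials_mult_power[OF spherical_polynomials_mult_power[OF
            spherical_polynomials_const[of 1 0]]]]]
      by (simp add: mult.assoc)
  qed
  then show ?thesis by simp
qed

section \<open>The reproducing kernel\<close>

text \<open>The kernel is zonal; this is its profile as a polynomial in the inner product.\<close>

definition kernel_poly :: "nat \<Rightarrow> real poly" where
  "kernel_poly n = (\<Sum>l\<le>n. smult ((2 * real l + 1) / (4 * pi)) (legendre_poly l))"

lemma kernel_poly_eq:
  "kernel_poly n = smult (1 / (4 * pi)) (pderiv (legendre_poly (n + 1) + legendre_poly n))"
  unfolding kernel_poly_def sum_legendre_poly[symmetric]
  by (simp add: poly_eq_iff coeff_sum sum_divide_distrib)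

lemma degree_kernel_poly: "degree (kernel_poly n) \<le> n"
  unfolding kernel_poly_def
  by (intro degree_sum_le) (auto intro!: order_trans[OF degree_smult_le] simp: degree_legendre_poly)

lemma reproducing_kernel_eq_poly: "reproducing_kernel n x y = poly (kernel_poly n) (x \<bullet> y)"
  by (simp add: reproducing_kernel_def kernel_poly_def poly_sum)

text \<open>In the integral of \<open>pderiv (h * F)\<close> only the end point 1 contributes, since
  \<open>F\<close> is 2 there and 0 at -1. The part \<open>pderiv h * F\<close> integrates to 0 by
  orthogonality, and \<open>pderiv F\<close> is the kernel up to the factor
  \<open>4 * pi\<close>.\<close>

lemma sphere_moment_kernel_poly_0:
  assumes "degree h \<le> n"
  shows "sphere_moment 0 0 (h * kernel_poly n) = poly h 1"
proof -
  define F where "F = legendre_poly (n + 1) + legendre_poly n"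
  have F: "poly F 1 = 2" "poly F (-1) = 0"
    by (simp_all add: F_def legendre_poly_1 legendre_poly_minus_1)
  have "sphere_moment 0 0 (pderiv h * legendre_poly (n + 1)) = 0"
    using assms by (intro sphere_moment_legendre_poly) (simp add: degree_pderiv)
  moreover have "sphere_moment 0 0 (pderiv h * legendre_poly n) = 0"
  \<comment> \<open>A constant \<open>h\<close> is treated apart: for \<open>n = 0\<close> no degree
    lies below \<open>n\<close>, but the derivative of \<open>h\<close> is zero.\<close>
  proof (cases "degree h = 0")
    case True
    then have "pderiv h = 0"
      by (simp add: pderiv_eq_0_iff)
    then show ?thesis
      by (simp add: sphere_moment_0)
  next
    case False
    then show ?thesis
      using assms by (intro sphere_moment_legendre_poly) (simp add: degree_pderiv)
  qed
  ultimately have "sphere_moment 0 0 (pderiv h * F) = 0"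
    by (simp add: F_def ring_distribs sphere_moment_add)
  moreover have "sphere_moment 0 0 (pderiv (h * F)) = 4 * pi * poly h 1"
    by (simp add: sphere_moment_pderiv F)
  ultimately have "sphere_moment 0 0 (h * pderiv F) = 4 * pi * poly h 1"
    by (simp add: pderiv_mult sphere_moment_add mult.commute)
  then show ?thesis
    by (simp add: kernel_poly_eq F_def sphere_moment_smult)
qed

text \<open>The kernel at the pole depends on \<open>y $ 3\<close> only, so each monomial of
  \<open>f\<close> gives a moment with a power of \<open>y $ 3\<close> as \<open>h\<close>. That
  power is 1 at the pole, which leaves \<open>0 ^ (i + j)\<close>, the value of the whole monomial
  there.\<close>

lemma reproducing_axis_3:
  assumes "f \<in> spherical_polynomials n"
  shows "sphere_integral (\<lambda>y. f y * poly (kernel_poly n) (y $ 3)) = f (axis 3 1)"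
proof -
  obtain c where c: "\<And>x. x \<in> S2 \<Longrightarrow> f x
    = (\<Sum>q\<in>{(i, j, k). i + j + k \<le> n}.
        c q * ((x $ 1) ^ fst q * (x $ 2) ^ fst (snd q) * (x $ 3) ^ snd (snd q)))"
    using spherical_polynomials_expand[OF assms] by blast
  have "sphere_integral (\<lambda>y. f y * poly (kernel_poly n) (y $ 3))
      = sphere_integral (\<lambda>y. \<Sum>q\<in>{(i, j, k). i + j + k \<le> n}. c q *
          ((y $ 1) ^ fst q * (y $ 2) ^ fst (snd q)
            * poly (monom 1 (snd (snd q)) * kernel_poly n) (y $ 3)))"
  proof (rule sphere_integral_cong)
    fix y :: "real ^ 3" assume y: "y \<in> S2"
    show "f y * poly (kernel_poly n) (y $ 3) = (\<Sum>q\<in>{(i, j, k). i + j + k \<le> n}. c q *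
          ((y $ 1) ^ fst q * (y $ 2) ^ fst (snd q)
            * poly (monom 1 (snd (snd q)) * kernel_poly n) (y $ 3)))"
      unfolding c[OF y] by (simp add: sum_distrib_right poly_monom mult.assoc)
  qed
  also have "\<dots> = (\<Sum>q\<in>{(i, j, k). i + j + k \<le> n}. c q *
      sphere_moment (fst q) (fst (snd q)) (monom 1 (snd (snd q)) * kernel_poly n))"
    unfolding sphere_moment_def
    by (subst sphere_integral_sum) (auto simp: sphere_integral_cmult intro!: continuous_intros)
  also have "\<dots> = (\<Sum>q\<in>{(i, j, k). i + j + k \<le> n}. c q * 0 ^ (fst q + fst (snd q)))"
    by (intro sum.cong refl) (auto simp: poly_monom degree_monom_eq
        intro!: sphere_moment_kernel[of n, OF sphere_moment_kernel_poly_0, THEN trans])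
  also have "\<dots> = f (axis 3 1)"
    by (subst c, simp) (simp add: axis_def power_add)
  finally show ?thesis .
qed

text \<open>An orthogonal map \<open>T\<close> carries the pole to \<open>x\<close>, so
  \<open>T y \<bullet> x = y $ 3\<close>, and the case of the pole applies to \<open>f\<close>
  composed with \<open>T\<close>.\<close>

lemma reproducing_property:
  assumes f: "f \<in> spherical_polynomials n" and x: "x \<in> S2"
  shows "sphere_integral (\<lambda>y. f y * reproducing_kernel n y x) = f x"
proof -
  obtain T where T: "orthogonal_transformation T" "T (axis 3 1 :: real ^ 3) = x"
    using orthogonal_transformation_exists_1[of "axis 3 1 :: real ^ 3" x] x by auto
  have eq: "T y \<bullet> x = y $ 3" for y
    using T by (auto simp: orthogonal_transformation_def inner_axis)
  have "continuous_on S2 (\<lambda>y. f y * reproducing_kernel n y x)"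
    unfolding reproducing_kernel_eq_poly
    by (intro continuous_intros continuous_on_spherical_polynomials[OF f])
  then have "sphere_integral (\<lambda>y. f y * reproducing_kernel n y x)
      = sphere_integral (\<lambda>y. f (T y) * reproducing_kernel n (T y) x)"
    by (rule sphere_integral_rotate[OF T(1), symmetric])
  also have "\<dots> = f x"
    unfolding reproducing_kernel_eq_poly eq
    using reproducing_axis_3[OF spherical_polynomials_orthogonal_transformation[OF T(1) f]]
    by (simp add: T)
  finally show ?thesis .
qed

section \<open>Hyperinterpolation and the error estimate\<close>

lemma hyperinterpolation_in_spherical_polynomials:
  "hyperinterpolation N X w n f \<in> spherical_polynomials n"
proof -
  have "(\<lambda>x. w j * f (X j) * reproducing_kernel n x (X j)) \<in> spherical_polynomials n" for j
    unfolding reproducing_kernel_eq_poly inner_commute[of _ "X j"]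
    by (intro spherical_polynomials_cmult spherical_polynomials_poly_inner degree_kernel_poly)
  then show ?thesis
    unfolding hyperinterpolation_def[abs_def] by (intro spherical_polynomials_sum)
qed

text \<open>The hyperinterpolant is a combination of kernels centred at the nodes, and integration
  against each of these evaluates \<open>f\<close> at its node.\<close>

lemma sphere_integral_mult_hyperinterpolation:
  assumes f: "f \<in> spherical_polynomials n" and X: "\<forall>j\<in>{1..N}. X j \<in> S2"
  shows "sphere_integral (\<lambda>x. f x * hyperinterpolation N X w n p x) = quadrature N X w (\<lambda>x. p x * f x)"
proof -
  have cont: "continuous_on S2 (\<lambda>x. f x * reproducing_kernel n x (X j))" for j
    unfolding reproducing_kernel_eq_poly
    by (intro continuous_intros continuous_on_spherical_polynomials[OF f])
  have "sphere_integral (\<lambda>x. f x * hyperinterpolation N X w n p x)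
      = sphere_integral (\<lambda>x. \<Sum>j = 1..N. w j * p (X j) * (f x * reproducing_kernel n x (X j)))"
    unfolding hyperinterpolation_def by (simp add: sum_distrib_left mult_ac)
  also have "\<dots> = (\<Sum>j = 1..N. w j * p (X j) * sphere_integral (\<lambda>x. f x * reproducing_kernel n x (X j)))"
    by (subst sphere_integral_sum) (auto simp only: sphere_integral_cmult intro!: continuous_on_mult_left cont)
  also have "\<dots> = quadrature N X w (\<lambda>x. p x * f x)"
    unfolding quadrature_def using X by (intro sum.cong) (auto simp: reproducing_property[OF f])
  finally show ?thesis .
qed

theorem proposition5p4:
  fixes N n :: nat
    and X :: "nat \<Rightarrow> real ^ 3"
    and w :: "nat \<Rightarrow> real"
    and A B \<eta> :: real
  assumes "\<forall>j\<in>{1..N}. X j \<in> S2"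
    and "L2_MZ_inequality N X w n A B"
    and "\<eta> = max \<bar>1 - A\<bar> \<bar>1 - B\<bar>"
  shows "\<forall>p \<in> spherical_polynomials n.
           sphere_L2_norm (\<lambda>x. hyperinterpolation N X w n p x - p x) \<le> \<eta> * sphere_L2_norm p"
proof
  fix p assume p: "p \<in> spherical_polynomials n"
  define I where "I f = sphere_integral (\<lambda>x. (f x)\<^sup>2)" for f
  define Q where "Q f = quadrature N X w f" for f
  define r where "r x = hyperinterpolation N X w n p x - p x" for x
  have r: "r \<in> spherical_polynomials n"
    unfolding r_def[abs_def]
    by (intro spherical_polynomials_diff hyperinterpolation_in_spherical_polynomials p)
  have cont: "continuous_on S2 p" "continuous_on S2 r"
      "continuous_on S2 (hyperinterpolation N X w n p)"
    using p r hyperinterpolation_in_spherical_polynomials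
    by (blast intro: continuous_on_spherical_polynomials)+
  have I0: "0 \<le> I f" for f
    unfolding I_def by (rule sphere_integral_nonneg) simp
  have AB: "1 - A \<le> \<eta>" "B - 1 \<le> \<eta>" "0 \<le> \<eta>"
    using assms(3) by auto
  have MZ: "\<bar>Q (\<lambda>x. (f x)\<^sup>2) - I f\<bar> \<le> \<eta> * I f" if "f \<in> spherical_polynomials n" for f
  proof -
    have "A * I f \<le> Q (\<lambda>x. (f x)\<^sup>2)" "Q (\<lambda>x. (f x)\<^sup>2) \<le> B * I f"
      using assms(2) that by (auto simp: L2_MZ_inequality_def I_def Q_def)
    moreover have "(1 - A) * I f \<le> \<eta> * I f" "(B - 1) * I f \<le> \<eta> * I f"
      using AB I0 by (auto intro: mult_right_mono)
    ultimately show ?thesis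
      by (simp add: algebra_simps abs_le_iff)
  qed
  \<comment> \<open>One factor \<open>r\<close> is written as the hyperinterpolant minus
    \<open>p\<close>; the other, a polynomial of degree at most \<open>n\<close>, serves as the test
    function.\<close>
  have Ir: "I r = Q (\<lambda>x. p x * r x) - sphere_integral (\<lambda>x. r x * p x)"
  proof -
    have "I r = sphere_integral (\<lambda>x. r x * hyperinterpolation N X w n p x - r x * p x)"
      unfolding I_def by (simp add: r_def power2_eq_square algebra_simps)
    also have "\<dots> = Q (\<lambda>x. p x * r x) - sphere_integral (\<lambda>x. r x * p x)"
      by (subst sphere_integral_diff)
        (auto simp: sphere_integral_mult_hyperinterpolation[OF r assms(1)] Q_def
          intro!: continuous_intros cont)
    finally show ?thesis .
  qed
  have lin: "I (\<lambda>x. p x + t * r x) = I p + t\<^sup>2 * I r + 2 * t * sphere_integral (\<lambda>x. r x * p x)"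
      "Q (\<lambda>x. (p x + t * r x)\<^sup>2)
        = Q (\<lambda>x. (p x)\<^sup>2) + t\<^sup>2 * Q (\<lambda>x. (r x)\<^sup>2) + 2 * t * Q (\<lambda>x. p x * r x)" for t
  proof -
    have "I (\<lambda>x. p x + t * r x) = sphere_integral (\<lambda>x. (p x)\<^sup>2 + t\<^sup>2 * (r x)\<^sup>2 + 2 * t * (r x * p x))"
      unfolding I_def by (simp add: power2_eq_square algebra_simps)
    also have "\<dots> = I p + t\<^sup>2 * I r + 2 * t * sphere_integral (\<lambda>x. r x * p x)"
      unfolding I_def
      by (subst sphere_integral_add; (intro continuous_intros cont)?)+ (simp add: sphere_integral_cmult)
    finally show "I (\<lambda>x. p x + t * r x) = \<dots>" .
    show "Q (\<lambda>x. (p x + t * r x)\<^sup>2)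
        = Q (\<lambda>x. (p x)\<^sup>2) + t\<^sup>2 * Q (\<lambda>x. (r x)\<^sup>2) + 2 * t * Q (\<lambda>x. p x * r x)"
      unfolding Q_def quadrature_def sum_distrib_left sum.distrib[symmetric]
      by (intro sum.cong refl) (simp add: power2_eq_square algebra_simps)
  qed
  \<comment> \<open>The bounds for \<open>t\<close> and \<open>- t\<close> are combined: the
    diagonal terms cancel and the cross terms, by \<open>Ir\<close>, add up to
    \<open>4 * t * I r\<close>.\<close>
  have polar: "2 * t * I r \<le> \<eta> * (I p + t\<^sup>2 * I r)" for t
  proof -
    have "\<bar>Q (\<lambda>x. (p x + s * r x)\<^sup>2) - I (\<lambda>x. p x + s * r x)\<bar> \<le> \<eta> * I (\<lambda>x. p x + s * r x)" for s
      by (intro MZ spherical_polynomials_add spherical_polynomials_cmult p r)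
    from this[of t] this[of "- t"] show ?thesis
      unfolding lin Ir[symmetric] by (simp add: algebra_simps Ir abs_le_iff)
  qed
  \<comment> \<open>The choice \<open>t = 1 / \<eta>\<close> gives the estimate without dividing by
    the norm of \<open>r\<close>, hence without a case distinction on \<open>r\<close>. For
    \<open>\<eta> = 0\<close> any positive \<open>t\<close> will do.\<close>
  have "I r \<le> \<eta>\<^sup>2 * I p"
  proof (cases "\<eta> = 0")
    case True
    then show ?thesis using polar[of 1] by simp
  next
    case False
    then have "\<eta> > 0" using AB by simp
    then show ?thesis
      using polar[of "1 / \<eta>"] by (simp add: field_simps power2_eq_square)
  qed
  then have "sqrt (I r) \<le> sqrt (\<eta>\<^sup>2 * I p)"
    by (rule real_sqrt_le_mono)
  also have "\<dots> = \<eta> * sqrt (I p)"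
    using AB by (simp add: real_sqrt_mult)
  finally show "sphere_L2_norm (\<lambda>x. hyperinterpolation N X w n p x - p x) \<le> \<eta> * sphere_L2_norm p"
    by (simp add: sphere_L2_norm_def I_def r_def[abs_def])
qed

end
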